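(* In the setting described in the context, suppose that $X_i$ is convex for all $i=1,\dots,n$. Run the Frank-Wolfe stage for $K\ge1$ iterations with target $z^*=(v^*,b)$, followed by the trimming stage, and let $\bar x=(\bar x_1,\dots,\bar x_n)\in\mathbb{R}^d$ be defined by $$\bar x_i=\sum_{l\in I_i}\alpha_l\,y_i^{k_l},\qquad i=1,\dots,n.$$ Then $$\sum_{i=1}^n f_i(\bar x_i)\le v^*+\frac{2D_{\mathcal C}}{\sqrt{K+1}}+(m+1)\max_i\rho(f_i),$$ $$\Big\|\sum_{i=1}^n A_i\bar x_i-b\Big\|_+\le\frac{2D_{\mathcal C}}{\sqrt{K+1}}.$$
   Context: Setting. For $i=1,\dots,n$, $f_i:\mathbb{R}^{d_i}\to\mathbb{R}\cup\{+\infty\}$ is proper, lower semicontinuous, has an affine minorant, and $X_i=\operatorname{dom}f_i$ is compact (neither $f_i$ nor $X_i$ is assumed convex in general). $A_i\in\mathbb{R}^{m\times d_i}$, $b\in\mathbb{R}^m$, $d=\sum_id_i$, $A=[A_1\cdots A_n]$. Vector inequalities are componentwise. $f_i^{**}$ is the Fenchel biconjugate, with $\operatorname{dom}f_i^{**}=\operatorname{conv}X_i$. For a vector $x$, $\|x\|_+=\sqrt{\sum_j\max(x_j,0)^2}$; $\|\cdot\|$ is the Euclidean norm. $\Delta_K=\{\gamma\in\mathbb{R}^K_+:\sum_k\gamma_k=1\}$. Nonconvexity: $\rho(f)=\sup\{f(\sum_{j=1}^p\alpha_jx_j)-\sum_{j=1}^p\alpha_jf(x_j): p\in\mathbb{N},\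 x_j\in\operatorname{dom}f,\ \alpha\in\Delta_p\}$. Dual value: $\Psi(\lambda)=\inf_{x_i\in X_i}\{\sum_if_i(x_i)+\lambda^\top(\sum_iA_ix_i-b)\}$ and $v^*=\max_{\lambda\ge0}\Psi(\lambda)$. Strong duality is assumed: $v^*$ equals the optimal value of the problem of minimizing $\sum_if_i^{**}(x_i)$ subject to $Ax\le b$, $x_i\in\operatorname{conv}X_i$. Sets: $\mathcal C_i=\{(f_i^{**}(x_i),A_ix_i):x_i\in\operatorname{conv}X_i\}\subset\mathbb{R}^{1+m}$, $\mathcal C=\sum_i\mathcal C_i$ (Minkowski sum), $D_{\mathcal C}=\sup_{z,z'\in\mathcal C}\|z-z'\|$. Frank-Wolfe stage with target $z^*\in\mathbb{R}^{1+m}$. Start from $z^0=\sum_i(f_i(y_i),A_iy_i)$ for some $y_i\in X_i$ with $f_i(y_i)=f_i^{**}(y_i)$. For $k=0,\dots,K-1$: let $v^k=\max(z^k-z^*,0)$ componentwise, written $v^k=(\alpha_k,g^k)\in\mathbb{R}\times\mathbb{R}^m$; for each $i$ choose $y_i^k\in\arg\min_{x_i\in\operatorname{conv}X_i}\{\alpha_kf_i^{**}(x_i)+(g^k)^\top A_ix_i\}$, chosen so that $y_i^k\in X_i$ and $f_i(y_i^k)=f_i^{**}(y_i^k)$ (this choice is a standing assumption); set $s^k=\sum_i(f_i(y_i^k),A_iy_i^k)$ and $z^{k+1}=(1-\eta_k)z^k+\eta_ks^k$, where either $\eta_k=\frac{2}{k+2}$ for all $k$, or $\eta_k=\min\big(1,\frac{(v^k)^\top(z^k-s^k)}{\|z^k-s^k\|^2}\big)$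 for all $k$ (any value in $[0,1]$ if $z^k=s^k$). The output is written $z^K=\sum_{k=0}^{K-1}\gamma_ks^k$ with $\gamma\in\Delta_K$ (this representation is part of the setting). Trimming stage. Let $w^K=(z^K,\mathbf 1_n)\in\mathbb{R}^{1+m+n}$, so $w^K=\sum_k\gamma_k\sum_i(f_i(y_i^k),A_iy_i^k,e_i)$ with $e_i$ the canonical basis of $\mathbb{R}^n$. An exact conic Carathéodory algorithm returns $\alpha\in\mathbb{R}^{n+m+1}_+$ and pairs $(i_l,k_l)\in\{1,\dots,n\}\times\{0,\dots,K-1\}$, $l=1,\dots,n+m+1$, with $$w^K=\sum_{l=1}^{n+m+1}\alpha_l\,\big(f_{i_l}(y_{i_l}^{k_l}),\,A_{i_l}y_{i_l}^{k_l},\,e_{i_l}\big).$$ Set $I_i=\{l:i_l=i\}$. *)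

theory Defs
  imports "HOL-Analysis.Analysis"
begin

section \<open>The spaces \<open>R^{d_i}\<close> and extended-valued functions on them\<close>

text \<open>
  The dimensions \<open>d_i\<close> may differ, so the spaces \<open>R^{d_i}\<close> cannot all be the same Euclidean type.
  We work in \<open>R^d = real^'d\<close>, where \<open>blk j\<close> tells which block coordinate \<open>j\<close> belongs to, and
  identify \<open>R^{d_i}\<close> with the coordinate subspace of the \<open>i\<close>-th block; thus \<open>d_i\<close> is the number of
  \<open>j\<close> with \<open>blk j = i\<close>, and \<open>d\<close> is the sum of the \<open>d_i\<close>. Under this identification
  \<open>A = [A_1 ... A_n]\<close> is one matrix, \<open>A_i x_i = A *v x_i\<close> for \<open>x_i\<close> in block \<open>i\<close>, and a point
  \<open>(x_1, ..., x_n)\<close> is a family \<open>x\<close> with \<open>x i\<close> in block \<open>i\<close>.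
  In the definitions below \<open>V\<close> stands for one of these subspaces; values of \<open>f\<close> outside \<open>V\<close>
  are never used.
\<close>

definition block :: "('d::finite \<Rightarrow> 'n) \<Rightarrow> 'n \<Rightarrow> (real^'d) set" where
  "block blk i = {x. \<forall>j. blk j \<noteq> i \<longrightarrow> x $ j = 0}"

definition edom :: "'a set \<Rightarrow> ('a \<Rightarrow> ereal) \<Rightarrow> 'a set" where
  "edom V f = {x \<in> V. f x < \<infinity>}"

definition proper_on :: "'a set \<Rightarrow> ('a \<Rightarrow> ereal) \<Rightarrow> bool" where
  "proper_on V f \<longleftrightarrow> (\<forall>x\<in>V. f x \<noteq> -\<infinity>) \<and> edom V f \<noteq> {}"

definition lsc_on :: "'a::topological_space set \<Rightarrow> ('a \<Rightarrow> ereal) \<Rightarrow> bool" where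
  "lsc_on V f \<longleftrightarrow> (\<forall>x\<in>V. f x \<le> Liminf (at x within V) f)"

definition has_affine_minorant :: "'a::real_inner set \<Rightarrow> ('a \<Rightarrow> ereal) \<Rightarrow> bool" where
  "has_affine_minorant V f \<longleftrightarrow> (\<exists>a\<in>V. \<exists>c. \<forall>x\<in>V. ereal (a \<bullet> x + c) \<le> f x)"

definition conjugate :: "'a::real_inner set \<Rightarrow> ('a \<Rightarrow> ereal) \<Rightarrow> 'a \<Rightarrow> ereal" where
  "conjugate V f y = (SUP x\<in>V. ereal (y \<bullet> x) - f x)"

definition biconjugate :: "'a::real_inner set \<Rightarrow> ('a \<Rightarrow> ereal) \<Rightarrow> 'a \<Rightarrow> ereal" where
  "biconjugate V f = conjugate V (conjugate V f)"

definition unit_simplex :: "nat \<Rightarrow> (nat \<Rightarrow> real) set" where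
  "unit_simplex p = {\<alpha>. (\<forall>j<p. 0 \<le> \<alpha> j) \<and> (\<Sum>j<p. \<alpha> j) = 1}"

definition nonconvexity :: "'a::real_vector set \<Rightarrow> ('a \<Rightarrow> ereal) \<Rightarrow> ereal" where
  "nonconvexity V f =
     Sup {f (\<Sum>j<p. \<alpha> j *\<^sub>R x j) - (\<Sum>j<p. ereal (\<alpha> j) * f (x j)) | p x \<alpha>.
            (\<forall>j<p. x j \<in> edom V f) \<and> \<alpha> \<in> unit_simplex p}"

definition norm_plus :: "real^'m \<Rightarrow> real" where
  "norm_plus x = sqrt (\<Sum>j\<in>UNIV. (max (x $ j) 0)\<^sup>2)"


section \<open>Dual value and strong duality\<close>

definition dual_fun ::
  "('d::finite \<Rightarrow> 'n::finite) \<Rightarrow> ('n \<Rightarrow> real^'d \<Rightarrow> ereal) \<Rightarrow> real^'d^'m \<Rightarrow> real^'m \<Rightarrow> real^'m \<Rightarrow> ereal" where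
  "dual_fun blk f A b lam =
     (INF x\<in>{x. \<forall>i. x i \<in> edom (block blk i) (f i)}.
        (\<Sum>i\<in>UNIV. f i (x i)) + ereal (lam \<bullet> ((\<Sum>i\<in>UNIV. A *v x i) - b)))"

text \<open>The order on \<open>real^'m\<close> is componentwise.\<close>

definition is_dual_value ::
  "('d::finite \<Rightarrow> 'n::finite) \<Rightarrow> ('n \<Rightarrow> real^'d \<Rightarrow> ereal) \<Rightarrow> real^'d^'m \<Rightarrow> real^'m \<Rightarrow> real \<Rightarrow> bool" where
  "is_dual_value blk f A b v \<longleftrightarrow>
     (\<exists>lam\<ge>0. dual_fun blk f A b lam = ereal v) \<and> (\<forall>lam\<ge>0. dual_fun blk f A b lam \<le> ereal v)"

definition convexified_value ::
  "('d::finite \<Rightarrow> 'n::finite) \<Rightarrow> ('n \<Rightarrow> real^'d \<Rightarrow> ereal) \<Rightarrow> real^'d^'m \<Rightarrow> real^'m \<Rightarrow> ereal" where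
  "convexified_value blk f A b =
     (INF x\<in>{x. (\<forall>i. x i \<in> convex hull (edom (block blk i) (f i))) \<and> (\<Sum>i\<in>UNIV. A *v x i) \<le> b}.
        \<Sum>i\<in>UNIV. biconjugate (block blk i) (f i) (x i))"


section \<open>The set \<open>C\<close> and its diameter\<close>

text \<open>
  \<open>R^{1+m}\<close> is \<open>real \<times> (real^'m)\<close>, whose norm is the Euclidean one. The biconjugate is finite on the
  convex hull of the domain, so \<open>real_of_ereal\<close> is harmless here. The diameter is extended-valued:
  a lower semicontinuous function need not be bounded above on its compact domain, and \<open>C\<close> need not
  be bounded (the library's \<open>diameter\<close> is only meaningful for bounded sets).
\<close>

definition C_block ::
  "('d::finite \<Rightarrow> 'n) \<Rightarrow> ('n \<Rightarrow> real^'d \<Rightarrow> ereal) \<Rightarrow> real^'d^'m \<Rightarrow> 'n \<Rightarrow> (real \<times> (real^'m)) set" where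
  "C_block blk f A i =
     (\<lambda>x. (real_of_ereal (biconjugate (block blk i) (f i) x), A *v x)) `
       (convex hull (edom (block blk i) (f i)))"

definition C_set ::
  "('d::finite \<Rightarrow> 'n::finite) \<Rightarrow> ('n \<Rightarrow> real^'d \<Rightarrow> ereal) \<Rightarrow> real^'d^'m \<Rightarrow> (real \<times> (real^'m)) set" where
  "C_set blk f A = {\<Sum>i\<in>UNIV. c i | c. \<forall>i. c i \<in> C_block blk f A i}"

definition ediameter :: "'a::real_normed_vector set \<Rightarrow> ereal" where
  "ediameter S = (SUP (z, z')\<in>S \<times> S. ereal (norm (z - z')))"


section \<open>Frank-Wolfe and trimming stages\<close>

definition admissible_point ::
  "('d::finite \<Rightarrow> 'n) \<Rightarrow> ('n \<Rightarrow> real^'d \<Rightarrow> ereal) \<Rightarrow> 'n \<Rightarrow> real^'d \<Rightarrow> bool" where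
  "admissible_point blk f i y \<longleftrightarrow>
     y \<in> edom (block blk i) (f i) \<and> f i y = biconjugate (block blk i) (f i) y"

definition point_value ::
  "('n \<Rightarrow> real^'d \<Rightarrow> ereal) \<Rightarrow> real^'d^'m \<Rightarrow> 'n \<Rightarrow> real^'d::finite \<Rightarrow> real \<times> (real^'m)" where
  "point_value f A i y = (real_of_ereal (f i y), A *v y)"

text \<open>
  \<open>sup u 0\<close> on \<open>real \<times> (real^'m)\<close> is the componentwise positive part of \<open>u\<close>.
\<close>

definition fw_step_dir :: "real \<times> (real^'m) \<Rightarrow> real \<times> (real^'m) \<Rightarrow> real \<times> (real^'m)" where
  "fw_step_dir zstar z = sup (z - zstar) 0"

definition fw_stepsizes ::
  "real \<times> (real^'m) \<Rightarrow> nat \<Rightarrow> (nat \<Rightarrow> real \<times> (real^'m)) \<Rightarrow> (nat \<Rightarrow> real \<times> (real^'m)) \<Rightarrow> (nat \<Rightarrow> real) \<Rightarrow> bool" where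
  "fw_stepsizes zstar K z s \<eta> \<longleftrightarrow>
     (\<forall>k<K. \<eta> k = 2 / (real k + 2)) \<or>
     (\<forall>k<K. if z k = s k then \<eta> k \<in> {0..1}
            else \<eta> k = min 1 (fw_step_dir zstar (z k) \<bullet> (z k - s k) / (norm (z k - s k))\<^sup>2))"

definition fw_run ::
  "('d::finite \<Rightarrow> 'n::finite) \<Rightarrow> ('n \<Rightarrow> real^'d \<Rightarrow> ereal) \<Rightarrow> real^'d^'m \<Rightarrow> real \<times> (real^'m) \<Rightarrow> nat \<Rightarrow>
   ('n \<Rightarrow> real^'d) \<Rightarrow> (nat \<Rightarrow> 'n \<Rightarrow> real^'d) \<Rightarrow> (nat \<Rightarrow> real \<times> (real^'m)) \<Rightarrow> (nat \<Rightarrow> real \<times> (real^'m)) \<Rightarrow>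
   (nat \<Rightarrow> real) \<Rightarrow> bool" where
  "fw_run blk f A zstar K y0 y s z \<eta> \<longleftrightarrow>
     (\<forall>i. admissible_point blk f i (y0 i)) \<and>
     z 0 = (\<Sum>i\<in>UNIV. point_value f A i (y0 i)) \<and>
     (\<forall>k<K.
        (\<forall>i. admissible_point blk f i (y k i) \<and>
             is_arg_min
               (\<lambda>x. ereal (fst (fw_step_dir zstar (z k))) * biconjugate (block blk i) (f i) x
                    + ereal (snd (fw_step_dir zstar (z k)) \<bullet> (A *v x)))
               (\<lambda>x. x \<in> convex hull (edom (block blk i) (f i)))
               (y k i)) \<and>
        s k = (\<Sum>i\<in>UNIV. point_value f A i (y k i)) \<and>
        z (Suc k) = (1 - \<eta> k) *\<^sub>R z k + \<eta> k *\<^sub>R s k) \<and>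
     fw_stepsizes zstar K z s \<eta>"

text \<open>
  \<open>trimming f A K y zK \<alpha> il kl\<close>: the weights \<open>\<alpha> l\<close> and pairs \<open>(il l, kl l)\<close>, for
  \<open>l = 0, ..., n + m\<close>, are a valid output of the conic Caratheodory step applied to
  \<open>(zK, 1, ..., 1)\<close> in \<open>R^{1+m+n}\<close>.
\<close>

definition trimming ::
  "('n::finite \<Rightarrow> real^'d \<Rightarrow> ereal) \<Rightarrow> real^'d^'m \<Rightarrow> nat \<Rightarrow> (nat \<Rightarrow> 'n \<Rightarrow> real^'d) \<Rightarrow> real \<times> (real^'m) \<Rightarrow>
   (nat \<Rightarrow> real) \<Rightarrow> (nat \<Rightarrow> 'n) \<Rightarrow> (nat \<Rightarrow> nat) \<Rightarrow> bool" where
  "trimming f A K y zK \<alpha> il kl \<longleftrightarrow>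
     (\<forall>l<CARD('n) + CARD('m) + 1. 0 \<le> \<alpha> l \<and> kl l < K) \<and>
     ((zK, (\<chi> i. 1)) :: (real \<times> (real^'m)) \<times> (real^'n)) =
       (\<Sum>l<CARD('n) + CARD('m) + 1.
          \<alpha> l *\<^sub>R (point_value f A (il l) (y (kl l) (il l)), axis (il l) 1))"

end

theory Submission
  imports Defs
begin

text \<open>
  Half the squared norm of \<open>(z - z*)\<^sub>+\<close> is a convex function of \<open>z\<close> with gradient \<open>(z - z*)\<^sub>+\<close>, which is
  \<open>1\<close>-Lipschitz. By strong duality there are points of \<open>C\<close> exceeding \<open>z* = (v*, b)\<close> by arbitrarily
  little, so this function has infimum \<open>0\<close> over the convex hull of \<open>C\<close>, and the Frank-Wolfe
  recurrence gives the rate. For the trimmed point, the \<open>n + m + 1\<close> atoms are spread over \<open>n\<close>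
  nonempty groups, so at most \<open>m + 1\<close> groups have more than one atom; only those groups pay the
  nonconvexity \<open>\<rho>(f_i)\<close>.
\<close>

section \<open>Extended-valued functions\<close>

lemma biconjugate_le:
  assumes "x \<in> V"
  shows "biconjugate V f x \<le> f x"
  unfolding biconjugate_def conjugate_def[of V "conjugate V f"]
proof (rule SUP_least)
  fix y assume "y \<in> V"
  have "ereal (y \<bullet> x) - f x \<le> conjugate V f y"
    unfolding conjugate_def by (rule SUP_upper[OF assms])
  then show "ereal (x \<bullet> y) - conjugate V f y \<le> f x"
    by (cases "f x"; cases "conjugate V f y") (auto simp: inner_commute)
qed

text \<open>The minorant caps the conjugate at its slope \<open>a\<close> by \<open>- c\<close>, so
  \<open>a\<close> is the witness in the outer supremum.\<close>

lemma biconjugate_ge_affine: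
  assumes "a \<in> V" and minor: "\<And>x. x \<in> V \<Longrightarrow> ereal (a \<bullet> x + c) \<le> f x"
  shows "ereal (a \<bullet> x + c) \<le> biconjugate V f x"
proof -
  have "conjugate V f a \<le> ereal (- c)"
    unfolding conjugate_def
  proof (rule SUP_least)
    fix x assume "x \<in> V"
    from minor[OF this] show "ereal (a \<bullet> x) - f x \<le> ereal (- c)"
      by (cases "f x") auto
  qed
  then have "ereal (a \<bullet> x + c) \<le> ereal (x \<bullet> a) - conjugate V f a"
    by (cases "conjugate V f a") (auto simp: inner_commute)
  also have "\<dots> \<le> biconjugate V f x"
    unfolding biconjugate_def conjugate_def[of V "conjugate V f"]
    by (rule SUP_upper[OF \<open>a \<in> V\<close>])
  finally show ?thesis .
qed

text \<open>The biconjugate is squeezed between the affine minorant and \<open>f\<close>. Finiteness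
  on \<open>edom V f\<close> suffices later: each domain is assumed convex and so equals its
  hull.\<close>

lemma biconjugate_finite:
  assumes "has_affine_minorant V f" "x \<in> edom V f"
  shows "\<bar>biconjugate V f x\<bar> \<noteq> \<infinity>"
proof -
  obtain a c where "a \<in> V" "\<And>x. x \<in> V \<Longrightarrow> ereal (a \<bullet> x + c) \<le> f x"
    using assms(1) unfolding has_affine_minorant_def by blast
  then have "ereal (a \<bullet> x + c) \<le> biconjugate V f x"
    by (rule biconjugate_ge_affine)
  moreover have "biconjugate V f x \<le> f x" "f x < \<infinity>"
    using assms(2) by (auto simp: edom_def biconjugate_le)
  ultimately show ?thesis by (cases "biconjugate V f x") simp_all
qed

lemma proper_on_finite:
  assumes "proper_on V f" "x \<in> edom V f"
  shows "\<bar>f x\<bar> \<noteq> \<infinity>"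
proof -
  have "f x \<noteq> - \<infinity>" "f x < \<infinity>"
    using assms unfolding proper_on_def edom_def by blast+
  then show ?thesis by (cases "f x") simp_all
qed

lemma sum_ereal_real_of_ereal:
  assumes "\<And>i. i \<in> I \<Longrightarrow> \<bar>g i\<bar> \<noteq> \<infinity>"
  shows "(\<Sum>i\<in>I. g i) = ereal (\<Sum>i\<in>I. real_of_ereal (g i))"
proof -
  have "(\<Sum>i\<in>I. g i) = (\<Sum>i\<in>I. ereal (real_of_ereal (g i)))"
    by (intro sum.cong refl) (simp add: assms ereal_real)
  then show ?thesis by simp
qed

lemma nonconvexity_upper:
  assumes "\<And>j. j < p \<Longrightarrow> x j \<in> edom V f" "\<alpha> \<in> unit_simplex p"
  shows "f (\<Sum>j<p. \<alpha> j *\<^sub>R x j) - (\<Sum>j<p. ereal (\<alpha> j) * f (x j)) \<le> nonconvexity V f"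
  unfolding nonconvexity_def using assms
  by (intro Sup_upper CollectI exI[of _ p] exI[of _ x] exI[of _ \<alpha>]) simp

text \<open>A one-point combination contributes \<open>f x - f x\<close>, which is 0 because
  \<open>f x\<close> is finite.\<close>

lemma nonconvexity_nonneg:
  assumes "proper_on V f"
  shows "0 \<le> nonconvexity V f"
proof -
  obtain x where x: "x \<in> edom V f" using assms by (auto simp: proper_on_def)
  have "f (\<Sum>j<Suc 0. 1 *\<^sub>R x) - (\<Sum>j<Suc 0. ereal 1 * f x) \<le> nonconvexity V f"
    by (rule nonconvexity_upper) (auto simp: x unit_simplex_def)
  with proper_on_finite[OF assms x] show ?thesis
    by (cases "f x") (auto simp: zero_ereal_def one_ereal_def)
qed

text \<open>Passes from combinations indexed by an initial segment of the naturals, as in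
  \<open>nonconvexity\<close>, to an arbitrary finite index set such as a trimming group. Convexity
  of the domain makes \<open>f\<close> finite at the combination, so the extended inequality becomes
  a real one.\<close>

lemma le_add_nonconvexity:
  assumes "proper_on V f" "convex (edom V f)"
    and I: "finite I" "\<And>l. l \<in> I \<Longrightarrow> x l \<in> edom V f"
    and a: "\<And>l. l \<in> I \<Longrightarrow> 0 \<le> a l" "sum a I = 1"
    and \<rho>: "nonconvexity V f \<le> ereal \<rho>"
  shows "real_of_ereal (f (\<Sum>l\<in>I. a l *\<^sub>R x l)) \<le> (\<Sum>l\<in>I. a l * real_of_ereal (f (x l))) + \<rho>"
proof -
  define r where "r y = real_of_ereal (f y)" for y
  have r: "f y = ereal (r y)" if "y \<in> edom V f" for y
    using proper_on_finite[OF assms(1) that] by (simp add: r_def ereal_real)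
  have mem: "(\<Sum>l\<in>I. a l *\<^sub>R x l) \<in> edom V f"
    by (rule convex_sum) (use assms in auto)
  obtain h where h: "bij_betw h {..<card I} I"
    using ex_bij_betw_nat_finite[OF I(1)] by (auto simp: atLeast0LessThan)
  then have h_in: "h j \<in> I" if "j < card I" for j using that by (auto simp: bij_betw_def)
  have "f (\<Sum>j<card I. a (h j) *\<^sub>R x (h j)) - (\<Sum>j<card I. ereal (a (h j)) * f (x (h j)))
      \<le> nonconvexity V f"
  proof (rule nonconvexity_upper)
    show "(\<lambda>j. a (h j)) \<in> unit_simplex (card I)"
      using a h_in sum.reindex_bij_betw[OF h, of a] by (auto simp: unit_simplex_def)
  qed (use I h_in in auto)
  also have "(\<Sum>j<card I. a (h j) *\<^sub>R x (h j)) = (\<Sum>l\<in>I. a l *\<^sub>R x l)"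
    by (rule sum.reindex_bij_betw[OF h])
  also have "(\<Sum>j<card I. ereal (a (h j)) * f (x (h j))) = (\<Sum>l\<in>I. ereal (a l) * f (x l))"
    by (rule sum.reindex_bij_betw[OF h])
  also have "\<dots> = (\<Sum>l\<in>I. ereal (a l * r (x l)))"
    by (intro sum.cong refl) (simp add: r I)
  finally have "ereal (r (\<Sum>l\<in>I. a l *\<^sub>R x l) - (\<Sum>l\<in>I. a l * r (x l))) \<le> ereal \<rho>"
    using r[OF mem] \<rho> by (simp del: ereal_less_eq)
  then show ?thesis by (simp add: r_def)
qed

section \<open>The componentwise positive part\<close>

text \<open>In a coordinate where \<open>u + w\<close> is positive, it is at most
  \<open>max u 0 + w\<close>; elsewhere the left side is 0. Squared, this is the quadratic upper
  bound expressing that the gradient is 1-Lipschitz.\<close>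

lemma norm_sup_add_le:
  fixes u w :: "'a::ordered_euclidean_space"
  shows "norm (sup (u + w) 0) \<le> norm (sup u 0 + w)"
  by (rule norm_le_componentwise)
    (auto simp: inner_Basis_sup_left inner_add_left sup_real_def max_def)

lemma inner_sup_zero:
  fixes u :: "'a::ordered_euclidean_space"
  shows "sup u 0 \<bullet> u = (norm (sup u 0))\<^sup>2"
proof -
  have "sup u 0 \<bullet> u = sup u 0 \<bullet> sup u 0"
    by (subst (1 2) euclidean_inner)
      (auto intro!: sum.cong simp: inner_Basis_sup_left sup_real_def max_def)
  then show ?thesis by (simp add: power2_norm_eq_inner)
qed

lemma norm_plus_eq_norm_sup: "norm_plus u = norm (sup u 0)"
  by (simp add: norm_plus_def norm_vec_def L2_set_def sup_vec_def sup_real_def)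

section \<open>The Frank-Wolfe rate\<close>

lemma fw_descent:
  fixes z s t :: "'a::ordered_euclidean_space" and h :: real
  shows "(norm (sup ((1 - h) *\<^sub>R z + h *\<^sub>R s - t) 0))\<^sup>2
    \<le> (norm (sup (z - t) 0))\<^sup>2 - 2 * h * (sup (z - t) 0 \<bullet> (z - s)) + h\<^sup>2 * (norm (z - s))\<^sup>2"
proof -
  have "(1 - h) *\<^sub>R z + h *\<^sub>R s - t = (z - t) + (- h) *\<^sub>R (z - s)"
    by (simp add: algebra_simps)
  then have "norm (sup ((1 - h) *\<^sub>R z + h *\<^sub>R s - t) 0) \<le> norm (sup (z - t) 0 + (- h) *\<^sub>R (z - s))"
    using norm_sup_add_le by metis
  then have "(norm (sup ((1 - h) *\<^sub>R z + h *\<^sub>R s - t) 0))\<^sup>2 \<le> (norm (sup (z - t) 0 + (- h) *\<^sub>R (z - s)))\<^sup>2"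
    by (rule power_mono) simp
  also have "(norm (p + (- h) *\<^sub>R q))\<^sup>2 = (norm p)\<^sup>2 - 2 * h * (p \<bullet> q) + h\<^sup>2 * (norm q)\<^sup>2" for p q :: 'a
    unfolding power2_norm_eq_inner
    by (simp add: inner_diff_left inner_diff_right inner_commute power2_eq_square algebra_simps)
  finally show ?thesis .
qed

text \<open>The clipped vertex \<open>h\<close> minimizes the convex quadratic over all
  \<open>x\<close> up to 1. If the vertex is at most 1, the difference is a multiple of a square;
  otherwise it has the nonnegative factor \<open>1 - x\<close>.\<close>

lemma exact_step_le:
  fixes p n h x :: real
  assumes "n > 0" "0 \<le> x" "x \<le> 1" and h: "h = min 1 (p / n)"
  shows "- 2 * h * p + h\<^sup>2 * n \<le> - 2 * x * p + x\<^sup>2 * n"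
proof (cases "p \<le> n")
  case True
  then have "h * n = p" using assms by (simp add: min_def field_simps)
  then have "(- 2 * x * p + x\<^sup>2 * n) - (- 2 * h * p + h\<^sup>2 * n) = n * (x - h)\<^sup>2"
    by (auto simp: power2_eq_square algebra_simps)
  then show ?thesis using assms(1) by (smt (verit) mult_nonneg_nonneg zero_le_power2)
next
  case False
  then have "h = 1" using assms by (simp add: min_def field_simps)
  have "(- 2 * x * p + x\<^sup>2 * n) - (- 2 * p + n) = (1 - x) * (2 * (p - n) + n * (1 - x))"
    by (simp add: power2_eq_square algebra_simps)
  also have "\<dots> \<ge> 0" using assms False by (intro mult_nonneg_nonneg add_nonneg_nonneg) auto
  finally show ?thesis using \<open>h = 1\<close> by simp
qed

lemma fw_rate_recurrence:
  fixes H :: "nat \<Rightarrow> real"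
  assumes rec: "\<And>k. k < K \<Longrightarrow> H (Suc k) \<le> (1 - 2 / (real k + 2)) * H k + (2 / (real k + 2))\<^sup>2 * B"
    and "0 \<le> B" "1 \<le> K"
  shows "H K \<le> 4 * B / (real K + 1)"
proof -
  have "H (Suc k) \<le> 4 * B / (real (Suc k) + 1)" if "k < K" for k
    using that
  proof (induction k)
    \<comment> \<open>The first weight is \<open>2 / 2 = 1\<close>, which erases \<open>H 0\<close>:
      the bound starts at \<open>H 1\<close> and is independent of the initial point.\<close>
    case 0
    with rec[of 0] assms(2) show ?case by simp
  next
    case (Suc k)
    define r where "r = real k"
    have r: "r \<ge> 0" by (simp add: r_def)
    have "H (Suc (Suc k)) \<le> (1 - 2 / (r + 3)) * H (Suc k) + (2 / (r + 3))\<^sup>2 * B"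
      using rec[OF Suc.prems] by (simp add: r_def add.commute)
    also have "\<dots> \<le> (1 - 2 / (r + 3)) * (4 * B / (r + 2)) + (2 / (r + 3))\<^sup>2 * B"
      using Suc r by (intro add_right_mono mult_left_mono) (auto simp: r_def add.commute)
    \<comment> \<open>The target bound is factored out; the remaining factor is at most 1 once
      \<open>r + 3\<close> is replaced by \<open>r + 2\<close>.\<close>
    also have "\<dots> = 4 * B / (r + 3) * ((r + 1) / (r + 2) + 1 / (r + 3))"
      using r by (simp add: divide_simps power2_eq_square) (simp add: algebra_simps)
    also have "\<dots> \<le> 4 * B / (r + 3) * ((r + 1) / (r + 2) + 1 / (r + 2))"
      using r assms(2) by (intro mult_left_mono add_left_mono divide_left_mono) auto
    also have "(r + 1) / (r + 2) + 1 / (r + 2) = 1"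
      using r by (simp add: field_simps)
    finally show ?case by (simp add: r_def add.commute)
  qed
  from this[of "K - 1"] assms(3) show ?thesis by simp
qed

text \<open>Either rule does at least as well in the quadratic bound as the weight
  \<open>2 / (k + 2)\<close>, so one recurrence covers both. If \<open>z k = s k\<close>, both sides
  vanish.\<close>

lemma fw_stepsizes_le_open_loop:
  assumes step: "fw_stepsizes t K z s \<eta>" and "k < K"
    and x: "x = 2 / (real k + 2)"
  shows "- 2 * \<eta> k * (fw_step_dir t (z k) \<bullet> (z k - s k)) + (\<eta> k)\<^sup>2 * (norm (z k - s k))\<^sup>2
    \<le> - 2 * x * (fw_step_dir t (z k) \<bullet> (z k - s k)) + x\<^sup>2 * (norm (z k - s k))\<^sup>2"
  using step[unfolded fw_stepsizes_def]
proof
  assume "\<forall>k<K. \<eta> k = 2 / (real k + 2)"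
  with \<open>k < K\<close> x show ?thesis by simp
next
  assume *: "\<forall>k<K. if z k = s k then \<eta> k \<in> {0..1}
            else \<eta> k = min 1 (fw_step_dir t (z k) \<bullet> (z k - s k) / (norm (z k - s k))\<^sup>2)"
  show ?thesis
  proof (cases "z k = s k")
    case False
    with * \<open>k < K\<close>
    have "\<eta> k = min 1 (fw_step_dir t (z k) \<bullet> (z k - s k) / (norm (z k - s k))\<^sup>2)" by auto
    then show ?thesis using False x by (intro exact_step_le) auto
  qed simp
qed

text \<open>\<open>H\<close> is twice the objective. The hypothesis \<open>gap\<close> is twice as
  strong as what convexity and infimum 0 alone would give, since the objective is quadratic along
  rays from \<open>t\<close>.\<close>

lemma fw_rate:
  assumes step: "\<And>k. k < K \<Longrightarrow> z (Suc k) = (1 - \<eta> k) *\<^sub>R z k + \<eta> k *\<^sub>R s k"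
    and sizes: "fw_stepsizes t K z s \<eta>"
    and gap: "\<And>k. k < K \<Longrightarrow> (norm (fw_step_dir t (z k)))\<^sup>2 \<le> fw_step_dir t (z k) \<bullet> (z k - s k)"
    and D: "\<And>k. k < K \<Longrightarrow> norm (z k - s k) \<le> D"
    and "1 \<le> K"
  shows "norm (fw_step_dir t (z K)) \<le> 2 * D / sqrt (real K + 1)"
proof -
  define H where "H k = (norm (fw_step_dir t (z k)))\<^sup>2" for k
  have "0 \<le> D" using D[of 0] \<open>1 \<le> K\<close> by (smt (verit) norm_ge_zero less_eq_Suc_le One_nat_def)
  have "H K \<le> 4 * D\<^sup>2 / (real K + 1)"
  proof (rule fw_rate_recurrence)
    fix k assume k: "k < K"
    define x where "x = 2 / (real k + 2)"
    have "x \<ge> 0" by (simp add: x_def)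
    have "H (Suc k) \<le> H k - 2 * \<eta> k * (fw_step_dir t (z k) \<bullet> (z k - s k)) + (\<eta> k)\<^sup>2 * (norm (z k - s k))\<^sup>2"
      unfolding H_def fw_step_dir_def step[OF k] by (rule fw_descent)
    also have "\<dots> \<le> H k - 2 * x * (fw_step_dir t (z k) \<bullet> (z k - s k)) + x\<^sup>2 * (norm (z k - s k))\<^sup>2"
      using fw_stepsizes_le_open_loop[OF sizes k x_def] by simp
    also have "\<dots> \<le> H k - 2 * x * H k + x\<^sup>2 * D\<^sup>2"
      using gap[OF k] D[OF k] \<open>x \<ge> 0\<close> unfolding H_def
      by (intro add_mono diff_mono mult_left_mono power_mono) auto
    \<comment> \<open>The factor \<open>1 - 2 * x\<close> is relaxed to \<open>1 - x\<close>, the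
      form that the recurrence lemma takes.\<close>
    also have "\<dots> \<le> (1 - x) * H k + x\<^sup>2 * D\<^sup>2"
      using mult_nonneg_nonneg[OF \<open>x \<ge> 0\<close>, of "H k"] by (simp add: H_def algebra_simps)
    finally show "H (Suc k) \<le> (1 - 2 / (real k + 2)) * H k + (2 / (real k + 2))\<^sup>2 * D\<^sup>2"
      by (simp add: x_def)
  qed (use \<open>1 \<le> K\<close> in auto)
  also have "\<dots> = (2 * D / sqrt (real K + 1))\<^sup>2"
    by (simp add: power_divide power_mult_distrib)
  finally show ?thesis
    unfolding H_def by (rule power2_le_imp_le) (use \<open>0 \<le> D\<close> in auto)
qed

text \<open>Keeps every update a convex combination. For the exact step, a nonnegative inner product
  rules out a negative quotient.\<close>

lemma fw_stepsizes_unit_interval: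
  assumes "fw_stepsizes t K z s \<eta>" "k < K" "0 \<le> fw_step_dir t (z k) \<bullet> (z k - s k)"
  shows "0 \<le> \<eta> k \<and> \<eta> k \<le> 1"
  using assms(1)[unfolded fw_stepsizes_def]
proof
  assume "\<forall>k<K. \<eta> k = 2 / (real k + 2)"
  with assms(2) show ?thesis by auto
next
  assume "\<forall>k<K. if z k = s k then \<eta> k \<in> {0..1}
            else \<eta> k = min 1 (fw_step_dir t (z k) \<bullet> (z k - s k) / (norm (z k - s k))\<^sup>2)"
  with assms(2) have "if z k = s k then \<eta> k \<in> {0..1}
            else \<eta> k = min 1 (fw_step_dir t (z k) \<bullet> (z k - s k) / (norm (z k - s k))\<^sup>2)" by blast
  with assms(3) show ?thesis by (auto split: if_splits)
qed

section \<open>The Frank-Wolfe stage\<close>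

lemma point_value_in_C_block:
  assumes "admissible_point blk f i x"
  shows "point_value f A i x \<in> C_block blk f A i"
  using assms unfolding admissible_point_def point_value_def C_block_def
  by (auto intro!: image_eqI[of _ _ x] hull_inc)

lemma sum_point_value_in_C_set:
  assumes "\<And>i. admissible_point blk f i (x i)"
  shows "(\<Sum>i\<in>UNIV. point_value f A i (x i)) \<in> C_set blk f A"
  unfolding C_set_def using point_value_in_C_block[OF assms] by blast

lemma near_target_in_C_set:
  assumes aff: "\<And>i. has_affine_minorant (block blk i) (f i)"
    and conv: "\<And>i. convex (edom (block blk i) (f i))"
    and sd: "ereal v = convexified_value blk f A b"
    and "e > 0"
  obtains c where "c \<in> C_set blk f A" "fst c \<le> v + e" "snd c \<le> b"
proof -
  have "convexified_value blk f A b < ereal (v + e)"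
    using \<open>e > 0\<close> by (simp add: sd[symmetric])
  then obtain x where x: "\<And>i. x i \<in> convex hull (edom (block blk i) (f i))"
    and le: "(\<Sum>i\<in>UNIV. A *v x i) \<le> b"
    and less: "(\<Sum>i\<in>UNIV. biconjugate (block blk i) (f i) (x i)) < ereal (v + e)"
    unfolding convexified_value_def INF_less_iff by auto
  have fin: "\<bar>biconjugate (block blk i) (f i) (x i)\<bar> \<noteq> \<infinity>" for i
    using x[of i] by (intro biconjugate_finite aff) (simp add: convex_hull_eq[THEN iffD2, OF conv])
  define c where "c i = (real_of_ereal (biconjugate (block blk i) (f i) (x i)), A *v x i)" for i
  have "c i \<in> C_block blk f A i" for i using x by (auto simp: c_def C_block_def)
  then have "(\<Sum>i\<in>UNIV. c i) \<in> C_set blk f A" unfolding C_set_def by blast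
  moreover have "fst (\<Sum>i\<in>UNIV. c i) \<le> v + e"
    using less by (simp add: fst_sum c_def sum_ereal_real_of_ereal[OF fin])
  moreover have "snd (\<Sum>i\<in>UNIV. c i) \<le> b"
    using le by (simp add: snd_sum c_def)
  ultimately show thesis by (rule that)
qed

text \<open>A linear functional on a Minkowski sum is minimized block by block, and the oracle
  points have equal \<open>f\<close> and biconjugate values.\<close>

lemma fw_oracle_minimizes:
  assumes aff: "\<And>i. has_affine_minorant (block blk i) (f i)"
    and conv: "\<And>i. convex (edom (block blk i) (f i))"
    and run: "fw_run blk f A t K y0 y s z \<eta>" and "k < K"
    and c: "c \<in> C_set blk f A"
  shows "fw_step_dir t (z k) \<bullet> s k \<le> fw_step_dir t (z k) \<bullet> c"
proof -
  define w where "w = fw_step_dir t (z k)"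
  obtain c' where c': "c = (\<Sum>i\<in>UNIV. c' i)" "\<And>i. c' i \<in> C_block blk f A i"
    using c unfolding C_set_def by auto
  have "w \<bullet> point_value f A i (y k i) \<le> w \<bullet> c' i" for i
  proof -
    let ?g = "biconjugate (block blk i) (f i)"
    have hull: "convex hull (edom (block blk i) (f i)) = edom (block blk i) (f i)"
      using conv by (simp add: convex_hull_eq)
    obtain x where x: "c' i = (real_of_ereal (?g x), A *v x)" "x \<in> edom (block blk i) (f i)"
      using c'(2)[of i] unfolding C_block_def hull by auto
    have adm: "y k i \<in> edom (block blk i) (f i)" "f i (y k i) = ?g (y k i)"
      using run \<open>k < K\<close> unfolding fw_run_def admissible_point_def by blast+
    have min: "is_arg_min (\<lambda>x. ereal (fst w) * ?g x + ereal (snd w \<bullet> (A *v x)))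
               (\<lambda>x. x \<in> convex hull (edom (block blk i) (f i))) (y k i)"
      using run \<open>k < K\<close> unfolding fw_run_def w_def by blast
    have le: "ereal (fst w) * ?g (y k i) + ereal (snd w \<bullet> (A *v y k i))
        \<le> ereal (fst w) * ?g x + ereal (snd w \<bullet> (A *v x))"
      using min x(2) unfolding hull by (auto simp: is_arg_min_def not_less)
    obtain p q where "?g (y k i) = ereal p" "?g x = ereal q"
      using biconjugate_finite[OF aff adm(1)] biconjugate_finite[OF aff x(2)]
      by (cases "?g (y k i)"; cases "?g x") auto
    with le adm(2) x(1) show ?thesis by (simp add: point_value_def inner_prod_def)
  qed
  then have "(\<Sum>i\<in>UNIV. w \<bullet> point_value f A i (y k i)) \<le> (\<Sum>i\<in>UNIV. w \<bullet> c' i)"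
    by (intro sum_mono)
  moreover have "s k = (\<Sum>i\<in>UNIV. point_value f A i (y k i))"
    using run \<open>k < K\<close> unfolding fw_run_def by auto
  ultimately show ?thesis by (simp add: c'(1) inner_sum_right w_def)
qed

text \<open>The direction \<open>w\<close> is nonnegative, so points exceeding the target by at most
  \<open>e\<close> in the first coordinate show that \<open>w \<bullet> s k\<close> is at most
  \<open>w \<bullet> (v, b)\<close> in the limit. Then \<open>w \<bullet> (z k - s k)\<close> is at
  least \<open>w \<bullet> (z k - (v, b))\<close>, which is the squared norm of
  \<open>w\<close>.\<close>

lemma fw_gap:
  assumes aff: "\<And>i. has_affine_minorant (block blk i) (f i)"
    and conv: "\<And>i. convex (edom (block blk i) (f i))"
    and sd: "ereal v = convexified_value blk f A b"
    and run: "fw_run blk f A (v, b) K y0 y s z \<eta>" and "k < K"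
  shows "(norm (fw_step_dir (v, b) (z k)))\<^sup>2 \<le> fw_step_dir (v, b) (z k) \<bullet> (z k - s k)"
proof -
  define w where "w = fw_step_dir (v, b) (z k)"
  have w0: "0 \<le> fst w" "0 \<le> snd w"
    by (simp_all add: w_def fw_step_dir_def)
  have approx: "w \<bullet> s k \<le> w \<bullet> (v, b) + e * fst w" if e: "e > 0" for e
  proof -
    obtain c where c: "c \<in> C_set blk f A" "fst c \<le> v + e" "snd c \<le> b"
      using near_target_in_C_set[OF aff conv sd e] .
    have "w \<bullet> s k \<le> w \<bullet> c"
      unfolding w_def by (rule fw_oracle_minimizes[OF aff conv run \<open>k < K\<close> c(1)])
    also have "w \<bullet> c = fst w * fst c + snd w \<bullet> snd c" by (simp add: inner_prod_def)
    also have "\<dots> \<le> fst w * (v + e) + snd w \<bullet> b"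
    proof (rule add_mono)
      show "snd w \<bullet> snd c \<le> snd w \<bullet> b"
        using w0 c(3) by (auto simp: inner_vec_def less_eq_vec_def intro!: sum_mono mult_left_mono)
    qed (use w0 c in \<open>auto intro: mult_left_mono\<close>)
    also have "\<dots> = w \<bullet> (v, b) + e * fst w" by (simp add: inner_prod_def algebra_simps)
    finally show ?thesis .
  qed
  have "w \<bullet> s k \<le> w \<bullet> (v, b)"
  proof (rule field_le_epsilon)
    fix e :: real assume "e > 0"
    \<comment> \<open>Adding 1 in the denominator keeps the slack positive and well defined when
      \<open>fst w = 0\<close>.\<close>
    then have "w \<bullet> s k \<le> w \<bullet> (v, b) + e / (fst w + 1) * fst w"
      using w0 by (intro approx) auto
    also have "\<dots> \<le> w \<bullet> (v, b) + e" using \<open>e > 0\<close> w0 by (simp add: field_simps)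
    finally show "w \<bullet> s k \<le> w \<bullet> (v, b) + e" .
  qed
  moreover have "w \<bullet> (z k - (v, b)) = (norm w)\<^sup>2"
    unfolding w_def fw_step_dir_def by (rule inner_sup_zero)
  ultimately show ?thesis by (simp add: w_def inner_diff_right)
qed

text \<open>The iterates are in the convex hull of \<open>C\<close>, but not necessarily in \<open>C\<close>: already \<open>C\<^sub>i\<close>, a graph, is
  not convex.\<close>

lemma fw_iterate_in_hull:
  assumes run: "fw_run blk f A t K y0 y s z \<eta>"
    and gap: "\<And>k. k < K \<Longrightarrow> 0 \<le> fw_step_dir t (z k) \<bullet> (z k - s k)"
    and "k \<le> K"
  shows "z k \<in> convex hull (C_set blk f A)"
  using \<open>k \<le> K\<close>
proof (induction k)
  case 0
  have "z 0 \<in> C_set blk f A"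
    using run sum_point_value_in_C_set[of blk f y0 A] by (auto simp: fw_run_def)
  then show ?case by (rule hull_inc)
next
  case (Suc k)
  then have "k < K" by simp
  then have "s k \<in> C_set blk f A" "z (Suc k) = (1 - \<eta> k) *\<^sub>R z k + \<eta> k *\<^sub>R s k"
    using run sum_point_value_in_C_set[of blk f "y k" A] by (auto simp: fw_run_def)
  moreover from this(1) have "s k \<in> convex hull (C_set blk f A)" by (rule hull_inc)
  moreover have "0 \<le> \<eta> k \<and> \<eta> k \<le> 1"
    using run gap[OF \<open>k < K\<close>] by (intro fw_stepsizes_unit_interval[OF _ \<open>k < K\<close>]) (auto simp: fw_run_def)
  ultimately show ?case
    using Suc by (simp add: convexD[OF convex_convex_hull])
qed

text \<open>The closed ball of radius \<open>D\<close> about \<open>y\<close> is convex and contains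
  \<open>S\<close>, so it contains the hull.\<close>

lemma norm_diff_hull_le:
  fixes S :: "'a::real_normed_vector set"
  assumes "\<And>x y. x \<in> S \<Longrightarrow> y \<in> S \<Longrightarrow> norm (x - y) \<le> D" "x \<in> convex hull S" "y \<in> S"
  shows "norm (x - y) \<le> D"
proof -
  have "convex hull S \<subseteq> cball y D"
    by (rule hull_minimal) (auto simp: dist_norm assms)
  with assms show ?thesis by (auto simp: dist_norm norm_minus_commute)
qed

section \<open>The trimming stage\<close>

text \<open>Surjectivity gives each fiber at least one element, and a non-singleton fiber at least
  two; summing over fibers counts \<open>L\<close>.\<close>

lemma card_multiple_fibers_le:
  fixes h :: "'a \<Rightarrow> 'n::finite"
  assumes "finite L" "h ` L = UNIV"
  shows "card {i. card {l \<in> L. h l = i} \<noteq> 1} + CARD('n) \<le> card L"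
proof -
  have ge: "1 \<le> card {l \<in> L. h l = i}" for i
  proof -
    have "i \<in> h ` L" by (simp add: assms)
    then have "{l \<in> L. h l = i} \<noteq> {}" by auto
    with \<open>finite L\<close> show ?thesis by (simp add: Suc_le_eq card_gt_0_iff)
  qed
  have "card {i. card {l \<in> L. h l = i} \<noteq> 1} + CARD('n)
      = (\<Sum>i\<in>UNIV. (if card {l \<in> L. h l = i} \<noteq> 1 then 1 else 0) + 1)"
    by (simp only: sum.distrib sum.inter_filter[symmetric] finite card_eq_sum) simp
  also have "\<dots> \<le> (\<Sum>i\<in>UNIV. card {l \<in> L. h l = i})"
  proof (rule sum_mono)
    fix i show "(if card {l \<in> L. h l = i} \<noteq> 1 then 1 else 0) + 1 \<le> card {l \<in> L. h l = i}"
      using ge[of i] by (cases "card {l \<in> L. h l = i} = 1") auto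
  qed
  also have "\<dots> = card L"
    using sum.group[OF \<open>finite L\<close>, of UNIV h "\<lambda>_. 1::nat"] by simp
  finally show ?thesis .
qed

text \<open>The \<open>axis\<close> coordinates of the conic identity make the weights of each group
  sum to 1, turning it into one convex combination per block; the other coordinates are regrouped,
  with \<open>A\<close> pulled out by linearity.\<close>

lemma trimming_decomposition:
  fixes f :: "'n::finite \<Rightarrow> real^'d \<Rightarrow> ereal" and A :: "real^'d^'m::finite"
  assumes "trimming f A K y zK \<alpha> il kl"
  defines "I \<equiv> \<lambda>i. {l. l < CARD('n) + CARD('m) + 1 \<and> il l = i}"
  shows "sum \<alpha> (I i) = 1"
    and "fst zK = (\<Sum>i\<in>UNIV. \<Sum>l\<in>I i. \<alpha> l * real_of_ereal (f i (y (kl l) i)))"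
    and "snd zK = (\<Sum>i\<in>UNIV. A *v (\<Sum>l\<in>I i. \<alpha> l *\<^sub>R y (kl l) i))"
proof -
  define N where "N = CARD('n) + CARD('m) + 1"
  have I: "I i = {l \<in> {..<N}. il l = i}" for i by (auto simp: I_def N_def)
  have eq: "((zK, (\<chi> i. 1)) :: (real \<times> (real^'m)) \<times> (real^'n)) =
       (\<Sum>l<N. \<alpha> l *\<^sub>R (point_value f A (il l) (y (kl l) (il l)), axis (il l) 1))"
    using assms(1) unfolding trimming_def N_def by blast
  have group: "(\<Sum>l<N. g l (il l)) = (\<Sum>i\<in>UNIV. \<Sum>l\<in>I i. g l i)" for g :: "nat \<Rightarrow> 'n \<Rightarrow> 'c::comm_monoid_add"
    unfolding I by (subst sum.group[of "{..<N}" UNIV il, symmetric]) (auto intro!: sum.cong)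
  have "1 = (\<Sum>l<N. \<alpha> l *\<^sub>R axis (il l) (1::real)) $ i"
    using arg_cong[OF eq, of "\<lambda>p. snd p $ i"] by (simp add: snd_sum)
  also have "\<dots> = (\<Sum>l<N. if il l = i then \<alpha> l else 0)"
    by (auto simp: axis_def intro!: sum.cong)
  also have "\<dots> = sum \<alpha> (I i)"
    unfolding I by (rule sum.inter_filter[symmetric]) simp
  finally show "sum \<alpha> (I i) = 1" by simp
  show "fst zK = (\<Sum>i\<in>UNIV. \<Sum>l\<in>I i. \<alpha> l * real_of_ereal (f i (y (kl l) i)))"
    using arg_cong[OF eq, of "\<lambda>p. fst (fst p)"]
    by (simp add: fst_sum point_value_def group[of "\<lambda>l i. \<alpha> l * real_of_ereal (f i (y (kl l) i))"])
  show "snd zK = (\<Sum>i\<in>UNIV. A *v (\<Sum>l\<in>I i. \<alpha> l *\<^sub>R y (kl l) i))"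
    using arg_cong[OF eq, of "\<lambda>p. snd (fst p)"]
    by (simp add: fst_sum snd_sum point_value_def group[of "\<lambda>l i. \<alpha> l *\<^sub>R (A *v y (kl l) i)"]
        linear_sum[OF matrix_vector_mul_linear] matrix_vector_mult_scaleR)
qed

lemma trimmed_value_le:
  fixes f :: "'n::finite \<Rightarrow> real^'d::finite \<Rightarrow> ereal" and A :: "real^'d^'m::finite"
  assumes proper: "\<And>i. proper_on (block blk i) (f i)"
    and conv: "\<And>i. convex (edom (block blk i) (f i))"
    and adm: "\<And>k i. k < K \<Longrightarrow> y k i \<in> edom (block blk i) (f i)"
    and trim: "trimming f A K y zK \<alpha> il kl"
    and xbar: "\<And>i. xbar i = (\<Sum>l\<in>{l. l < CARD('n) + CARD('m) + 1 \<and> il l = i}. \<alpha> l *\<^sub>R y (kl l) i)"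
    and \<rho>: "\<And>i. nonconvexity (block blk i) (f i) \<le> ereal \<rho>"
  shows "(\<Sum>i\<in>UNIV. f i (xbar i)) \<le> ereal (fst zK + (real CARD('m) + 1) * \<rho>)"
proof -
  define I where "I i = {l. l < CARD('n) + CARD('m) + 1 \<and> il l = i}" for i
  note dec = trimming_decomposition[OF trim, folded I_def]
  have fin: "finite (I i)" for i by (simp add: I_def)
  have \<alpha>0: "0 \<le> \<alpha> l" and kl: "kl l < K" if "l \<in> I i" for l i
    using trim that by (auto simp: trimming_def I_def)
  have mem: "y (kl l) i \<in> edom (block blk i) (f i)" if "l \<in> I i" for l i
    using adm kl[OF that] by auto
  have xb: "xbar i = (\<Sum>l\<in>I i. \<alpha> l *\<^sub>R y (kl l) i)" for i
    by (simp add: xbar I_def)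
  have xdom: "xbar i \<in> edom (block blk i) (f i)" for i
    unfolding xb by (rule convex_sum) (use fin conv dec(1) \<alpha>0 mem in auto)
  \<comment> \<open>Nonnegativity of \<open>\<rho>\<close> permits replacing the number of paying
    groups by its upper bound at the end.\<close>
  have "ereal 0 \<le> ereal \<rho>"
    using nonconvexity_nonneg[OF proper] \<rho> by (metis order_trans zero_ereal_def)
  then have \<rho>0: "0 \<le> \<rho>" by simp
  have bound: "real_of_ereal (f i (xbar i))
      \<le> (\<Sum>l\<in>I i. \<alpha> l * real_of_ereal (f i (y (kl l) i))) + (if card (I i) \<noteq> 1 then \<rho> else 0)" for i
  proof (cases "card (I i) = 1")
    \<comment> \<open>The only weight of a singleton group is 1, so \<open>xbar i\<close> is the
      atom itself and there is no error.\<close>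
    case True
    then obtain l where "I i = {l}" by (rule card_1_singletonE)
    with dec(1)[of i] show ?thesis by (simp add: xb)
  next
    case False
    have "real_of_ereal (f i (xbar i)) \<le> (\<Sum>l\<in>I i. \<alpha> l * real_of_ereal (f i (y (kl l) i))) + \<rho>"
      unfolding xb
      by (rule le_add_nonconvexity[OF proper conv fin _ _ dec(1) \<rho>]) (use mem \<alpha>0 in auto)
    with False show ?thesis by simp
  qed
  have "il ` {..<CARD('n) + CARD('m) + 1} = UNIV"
  proof -
    have "i \<in> il ` {..<CARD('n) + CARD('m) + 1}" for i
    proof -
      have "I i \<noteq> {}" using dec(1)[of i] by auto
      then show ?thesis by (auto simp: I_def)
    qed
    then show ?thesis by auto
  qed
  \<comment> \<open>With \<open>n + m + 1\<close> atoms in \<open>n\<close> nonempty groups, at most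
    \<open>m + 1\<close> groups are not singletons.\<close>
  from card_multiple_fibers_le[OF _ this]
  have "card {i. card (I i) \<noteq> 1} \<le> CARD('m) + 1" by (simp add: I_def)
  then have count: "real (card {i. card (I i) \<noteq> 1}) \<le> real CARD('m) + 1"
    by (metis of_nat_Suc Suc_eq_plus1 add.commute of_nat_le_iff)
  have "(\<Sum>i\<in>UNIV. f i (xbar i)) = ereal (\<Sum>i\<in>UNIV. real_of_ereal (f i (xbar i)))"
    by (rule sum_ereal_real_of_ereal) (rule proper_on_finite[OF proper xdom])
  also have "(\<Sum>i\<in>UNIV. real_of_ereal (f i (xbar i)))
      \<le> (\<Sum>i\<in>UNIV. (\<Sum>l\<in>I i. \<alpha> l * real_of_ereal (f i (y (kl l) i))) + (if card (I i) \<noteq> 1 then \<rho> else 0))"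
    by (rule sum_mono) (rule bound)
  also have "\<dots> = fst zK + real (card {i. card (I i) \<noteq> 1}) * \<rho>"
    by (simp add: sum.distrib dec(2) sum.inter_filter[symmetric, of UNIV, simplified])
  also have "\<dots> \<le> fst zK + (real CARD('m) + 1) * \<rho>"
    using count \<rho>0 by (intro add_left_mono mult_right_mono)
  finally show ?thesis by simp
qed

section \<open>Combining the Frank-Wolfe rate with trimming\<close>

theorem theorem3p2:
  fixes blk :: "'d::finite \<Rightarrow> 'n::finite"
    and f :: "'n \<Rightarrow> real^'d \<Rightarrow> ereal"
    and A :: "real^'d^'m::finite"
    and b :: "real^'m"
    and v :: real
    and K :: nat
    and y0 :: "'n \<Rightarrow> real^'d"
    and y :: "nat \<Rightarrow> 'n \<Rightarrow> real^'d"
    and s z :: "nat \<Rightarrow> real \<times> (real^'m)"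
    and \<eta> \<gamma> \<alpha> :: "nat \<Rightarrow> real"
    and il :: "nat \<Rightarrow> 'n"
    and kl :: "nat \<Rightarrow> nat"
    and xbar :: "'n \<Rightarrow> real^'d"
  assumes "\<And>i. proper_on (block blk i) (f i)"
    and "\<And>i. lsc_on (block blk i) (f i)"
    and "\<And>i. has_affine_minorant (block blk i) (f i)"
    and "\<And>i. compact (edom (block blk i) (f i))"
    and "\<And>i. convex (edom (block blk i) (f i))"
    and "is_dual_value blk f A b v"
    and strong_duality: "ereal v = convexified_value blk f A b"
    and "K \<ge> 1"
    and "fw_run blk f A (v, b) K y0 y s z \<eta>"
    and "\<gamma> \<in> unit_simplex K"
    and "z K = (\<Sum>k<K. \<gamma> k *\<^sub>R s k)"
    and "trimming f A K y (z K) \<alpha> il kl"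
    and "\<And>i. xbar i = (\<Sum>l\<in>{l. l < CARD('n) + CARD('m) + 1 \<and> il l = i}. \<alpha> l *\<^sub>R y (kl l) i)"
  shows "(\<Sum>i\<in>UNIV. f i (xbar i))
           \<le> ereal v + 2 * ediameter (C_set blk f A) / ereal (sqrt (real K + 1))
             + ereal (real CARD('m) + 1) * (MAX i. nonconvexity (block blk i) (f i))
         \<and> ereal (norm_plus ((\<Sum>i\<in>UNIV. A *v xbar i) - b))
           \<le> 2 * ediameter (C_set blk f A) / ereal (sqrt (real K + 1))"
proof -
  note proper = assms(1) and aff = assms(3) and conv = assms(5) and run = assms(9)
  define t where "t = (v, b)"
  let ?C = "C_set blk f A" and ?D = "ediameter (C_set blk f A)"
  let ?R = "MAX i. nonconvexity (block blk i) (f i)"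
  have run_pt: "admissible_point blk f i (y k i)"
    and run_s: "s k = (\<Sum>i\<in>UNIV. point_value f A i (y k i))" if "k < K" for k i
    using run that by (auto simp: fw_run_def)
  have R_ub: "nonconvexity (block blk i) (f i) \<le> ?R" for i
    by (rule Max_ge) auto
  have R0: "0 \<le> ?R"
    using nonconvexity_nonneg[OF proper] R_ub by (rule order_trans)
  have s_in: "s k \<in> ?C" if "k < K" for k
    unfolding run_s[OF that] by (rule sum_point_value_in_C_set) (rule run_pt[OF that])
  have diam: "ereal (norm (c - c')) \<le> ?D" if "c \<in> ?C" "c' \<in> ?C" for c c'
    unfolding ediameter_def using that
    by (intro SUP_upper2[of "(c, c')"]) auto
  have D0: "0 \<le> ?D"
    using diam[OF s_in s_in, of 0 0] \<open>K \<ge> 1\<close> by (simp add: zero_ereal_def)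
  have gap: "(norm (fw_step_dir t (z k)))\<^sup>2 \<le> fw_step_dir t (z k) \<bullet> (z k - s k)" if "k < K" for k
    unfolding t_def by (rule fw_gap[OF aff conv strong_duality run that])
  show ?thesis
  \<comment> \<open>The diameter may be infinite, and then both right-hand sides are infinite. It is
    not negative, as \<open>s 0\<close> lies in \<open>?C\<close>.\<close>
  proof (cases ?D)
    case (real D)
    have "norm (fw_step_dir t (z K)) \<le> 2 * D / sqrt (real K + 1)"
    proof (rule fw_rate)
      fix k assume k: "k < K"
      show "z (Suc k) = (1 - \<eta> k) *\<^sub>R z k + \<eta> k *\<^sub>R s k"
        using run k by (auto simp: fw_run_def)
      have "z k \<in> convex hull ?C"
      proof (rule fw_iterate_in_hull[OF run])
        fix k assume "k < K"
        show "0 \<le> fw_step_dir (v, b) (z k) \<bullet> (z k - s k)"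
          using order_trans[OF zero_le_power2 gap[OF \<open>k < K\<close>]] by (simp add: t_def)
      qed (use k in simp)
      then show "norm (z k - s k) \<le> D"
        by (rule norm_diff_hull_le[rotated]) (use diam s_in[OF k] in \<open>auto simp: real\<close>)
    qed (use gap run \<open>K \<ge> 1\<close> in \<open>auto simp: fw_run_def t_def\<close>)
    \<comment> \<open>The norm of the pair dominates each component: the first bounds the excess in
      value, the second the infeasibility.\<close>
    moreover have "fw_step_dir t (z K) = (sup (fst (z K) - v) 0, sup (snd (z K) - b) 0)"
      by (simp add: fw_step_dir_def t_def prod_eq_iff)
    ultimately have "norm (sup (fst (z K) - v) 0) \<le> 2 * D / sqrt (real K + 1)"
      and feas: "norm (sup (snd (z K) - b) 0) \<le> 2 * D / sqrt (real K + 1)"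
      using norm_fst_le norm_snd_le order_trans by metis+
    then have val: "fst (z K) \<le> v + 2 * D / sqrt (real K + 1)"
      by (auto simp: sup_real_def max_def split: if_splits)
    have ratio: "2 * ?D / ereal (sqrt (real K + 1)) = ereal (2 * D / sqrt (real K + 1))"
      by (simp add: real)
    \<comment> \<open>Trimming preserves \<open>snd (z K)\<close> exactly, so it adds no
      infeasibility.\<close>
    have "norm_plus ((\<Sum>i\<in>UNIV. A *v xbar i) - b) \<le> 2 * D / sqrt (real K + 1)"
      using feas by (simp add: norm_plus_eq_norm_sup trimming_decomposition(3)[OF assms(12)] assms(13))
    moreover have "(\<Sum>i\<in>UNIV. f i (xbar i))
       \<le> ereal v + ereal (2 * D / sqrt (real K + 1)) + ereal (real CARD('m) + 1) * ?R"
    \<comment> \<open>An infinite nonconvexity makes the value bound trivial, because its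
      coefficient \<open>m + 1\<close> is positive.\<close>
    proof (cases ?R)
      case (real \<rho>)
      have "(\<Sum>i\<in>UNIV. f i (xbar i)) \<le> ereal (fst (z K) + (real CARD('m) + 1) * \<rho>)"
      proof (rule trimmed_value_le[OF proper conv _ assms(12,13)])
        show "nonconvexity (block blk i) (f i) \<le> ereal \<rho>" for i
          using R_ub[of i] by (simp only: real)
      qed (use run_pt in \<open>auto simp: admissible_point_def\<close>)
      also have "\<dots> \<le> ereal (v + 2 * D / sqrt (real K + 1) + (real CARD('m) + 1) * \<rho>)"
        using val by simp
      finally show ?thesis unfolding real by simp
    qed (use R0 in auto)
    ultimately show ?thesis unfolding ratio by simp
  next
    case PInf
    have "0 \<le> ereal (real CARD('m) + 1) * ?R"
      using R0 by (intro ereal_0_le_mult) auto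
    then show ?thesis unfolding PInf by (auto simp: ereal_mult_infty)
  next
    case MInf
    with D0 show ?thesis by simp
  qed
qed

end
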